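(* For every $(a,b)\in[-1,-\tfrac12]\times[\tfrac12,1]$, the topological entropy of $\tilde f_{a,b}:[-1,1]\to[-1,1]$ (and, therefore, of $f_{a,b}:\overline{\mathbb R}\to\overline{\mathbb R}$) equals $\log\left(\frac{1+\sqrt5}{2}\right)$.
   Context: Let $\overline{\mathbb R}=\mathbb R\cup\{\infty\}$ and let $\mathcal P=\{(a,b)\in\mathbb R^2 : a\le 0\le b,\ b-a\ge 1,\ -ab\le 1\}$ (note that $[-1,-\tfrac12]\times[\tfrac12,1]\subset\mathcal P$). For $(a,b)\in\mathcal P$ define $f_{a,b}:\overline{\mathbb R}\to\overline{\mathbb R}$ by $f_{a,b}(x)=x+1$ if $x<a$, $f_{a,b}(x)=-1/x$ if $a\le x<b$, and $f_{a,b}(x)=x-1$ if $x\ge b$ (with $-1/0=\infty$ and $f_{a,b}(\infty)=\infty$). Let $k(x)=\frac{x}{1+|x|}$, a homeomorphism from $\overline{\mathbb R}$ to $[-1,1]/{\sim}$, where $-1$ and $1$ are identified (both correspond to $\infty$); one writes simply $[-1,1]$ and treats the resulting maps as interval maps. Let $T(x)=x+1$, $S(x)=-1/x$, $\tilde T=k\circ T\circ k^{-1}$, $\tilde S=k\circ S\circ k^{-1}$. The map $\tilde f_{a,b}=k\circ f_{a,b}\circ k^{-1}:[-1,1]\to[-1,1]$ is thus given by $\tilde f_{a,b}(x)=\tilde T(x)$ if $-1\le x<k(a)=\frac{a}{1-a}$; $\tilde f_{a,b}(x)=\tilde S(x)$ if $k(a)\le x<k(b)=\frac{b}{1+b}$;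 $\tilde f_{a,b}(x)=\tilde T^{-1}(x)$ if $k(b)\le x\le 1$. Here $\tilde T(-1)=-1$, $\tilde T^{-1}(1)=1$, and $\tilde S(x)=x+1$ for $x<0$, $\tilde S(x)=x-1$ for $x>0$, while $\tilde S(0)$ is the point $\pm1$ (the choice of representative is immaterial). For a piecewise continuous, piecewise monotone map $f$ of an interval, the topological entropy is $h_{\rm top}(f)=\lim_{n\to\infty}\frac{1}{n}\log(\#\text{ of laps of }f^n)$, where a lap is a maximal interval of monotonicity. The topological entropy of $f_{a,b}$ is understood via the conjugacy $k$, i.e. $h_{\rm top}(f_{a,b})=h_{\rm top}(\tilde f_{a,b})$. *)

theory Defs
  imports "HOL-Analysis.Analysis"
begin

section \<open>The maps \<open>f\<^sub>a\<^sub>,\<^sub>b\<close> on the extended real line\<close>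

text \<open>
  The one-point compactification of the real line is modelled on \<^typ>\<open>real option\<close>, with
  \<^term>\<open>None\<close> playing the role of the point at infinity (the same encoding as in the library's
  Alexandroff compactification).
\<close>

type_synonym rbar = "real option"

definition mapT :: "rbar \<Rightarrow> rbar" where
  "mapT = map_option (\<lambda>x. x + 1)"

definition mapTinv :: "rbar \<Rightarrow> rbar" where
  "mapTinv = map_option (\<lambda>x. x - 1)"

definition mapS :: "rbar \<Rightarrow> rbar" where
  "mapS p = (case p of None \<Rightarrow> Some 0 | Some x \<Rightarrow> if x = 0 then None else Some (- 1 / x))"

definition paramP :: "(real \<times> real) set" where
  "paramP = {(a, b). a \<le> 0 \<and> 0 \<le> b \<and> b - a \<ge> 1 \<and> - (a * b) \<le> 1}"

definition fab :: "real \<Rightarrow> real \<Rightarrow> rbar \<Rightarrow> rbar" where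
  "fab a b p = (case p of None \<Rightarrow> None
     | Some x \<Rightarrow> if x < a then mapT p else if x < b then mapS p else mapTinv p)"

lemma square_subset_paramP: "{-1..-1/2} \<times> {1/2..1} \<subseteq> paramP"
proof -
  have "- (a * b) \<le> 1" if "-1 \<le> a" "a \<le> -1/2" "1/2 \<le> b" "b \<le> 1" for a b :: real
    using mult_mono[of "-a" 1 b 1] that by simp
  then show ?thesis by (auto simp: paramP_def)
qed


section \<open>Passage to the interval \<open>[-1,1]\<close>\<close>

definition kmap :: "real \<Rightarrow> real" where
  "kmap x = x / (1 + \<bar>x\<bar>)"

text \<open>The inverse of \<open>k\<close>, as a map from \<open>[-1,1]\<close>; both end points represent infinity.\<close>

definition kinv :: "real \<Rightarrow> rbar" where
  "kinv y = (if \<bar>y\<bar> = 1 then None else Some (y / (1 - \<bar>y\<bar>)))"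

text \<open>
  The interval version \<open>k \<circ> g \<circ> k\<^sup>-\<^sup>1\<close> of a self-map \<open>g\<close> of the extended real line. Since infinity
  is represented by both \<open>-1\<close> and \<open>1\<close>, a representative has to be chosen whenever the value is
  infinity: an end point that is mapped to infinity is kept fixed, and the parameter \<open>e\<close>
  (meant to be \<open>-1\<close> or \<open>1\<close>) is used at interior points.
\<close>

definition kconj :: "real \<Rightarrow> (rbar \<Rightarrow> rbar) \<Rightarrow> real \<Rightarrow> real" where
  "kconj e g x = (case g (kinv x) of Some y \<Rightarrow> kmap y | None \<Rightarrow> if \<bar>x\<bar> = 1 then x else e)"

definition ftilde :: "real \<Rightarrow> real \<Rightarrow> real \<Rightarrow> real \<Rightarrow> real" where
  "ftilde e a b = kconj e (fab a b)"


section \<open>Laps and topological entropy\<close>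

definition monotone_interval :: "(real \<Rightarrow> real) \<Rightarrow> real set \<Rightarrow> bool" where
  "monotone_interval f J \<longleftrightarrow> is_interval J \<and> (mono_on J f \<or> antimono_on J f)"

definition laps :: "real set \<Rightarrow> (real \<Rightarrow> real) \<Rightarrow> real set set" where
  "laps I f = {J. J \<subseteq> I \<and> monotone_interval f J \<and>
     (\<forall>J'. J \<subseteq> J' \<and> J' \<subseteq> I \<and> monotone_interval f J' \<longrightarrow> J' = J)}"

text \<open>
  A predicate rather than a function, so that existence of the limit is part of the assertion.
  An infinite set of laps has cardinality \<open>0\<close> and contributes the term \<open>0\<close>, so a nonzero limit
  forces all but finitely many iterates to have finitely many laps.
\<close>

definition has_htop :: "real set \<Rightarrow> (real \<Rightarrow> real) \<Rightarrow> real \<Rightarrow> bool" where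
  "has_htop I f h \<longleftrightarrow> (\<lambda>n. 1 / real n * ln (real (card (laps I (f ^^ n))))) \<longlonglongrightarrow> h"

text \<open>
  For self-maps of the extended real line, the entropy is that of the interval version; it is
  required to be the same for both choices of the representative.
\<close>

definition has_htop_rbar :: "(rbar \<Rightarrow> rbar) \<Rightarrow> real \<Rightarrow> bool" where
  "has_htop_rbar g h \<longleftrightarrow> (\<forall>e\<in>{-1, 1}. has_htop {-1..1} (kconj e g) h)"


section \<open>The explicit form of the interval maps\<close>

lemma kmap_nonpos: "a \<le> 0 \<Longrightarrow> kmap a = a / (1 - a)"
  and kmap_nonneg: "0 \<le> b \<Longrightarrow> kmap b = b / (1 + b)"
  by (simp_all add: kmap_def)

lemma abs_kmap_less_1: "\<bar>kmap x\<bar> < 1"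
  by (simp add: kmap_def abs_divide)

lemma kinv_kmap: "kinv (kmap x) = Some x"
proof -
  have "1 - \<bar>kmap x\<bar> = 1 / (1 + \<bar>x\<bar>)"
    by (simp add: kmap_def abs_divide field_simps)
  then have "kmap x / (1 - \<bar>kmap x\<bar>) = x"
    by (simp add: kmap_def field_simps)
  then show ?thesis
    using abs_kmap_less_1[of x] by (simp add: kinv_def)
qed

lemma kmap_kinv: "\<bar>y\<bar> < 1 \<Longrightarrow> kmap (y / (1 - \<bar>y\<bar>)) = y"
  by (simp add: kmap_def abs_divide field_simps)

lemma kmap_strict_mono: "strict_mono kmap"
proof (rule strict_monoI)
  fix x y :: real assume "x < y"
  then consider "0 \<le> x" | "x < 0" "0 \<le> y" | "y < 0" by linarith
  then show "kmap x < kmap y"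
  proof cases
    case 1 then show ?thesis using \<open>x < y\<close> by (simp add: kmap_def field_simps)
  next
    case 2
    then have "kmap x < 0" "0 \<le> kmap y" by (auto simp: kmap_def divide_neg_pos)
    then show ?thesis by simp
  next
    case 3 then show ?thesis using \<open>x < y\<close> by (simp add: kmap_def field_simps)
  qed
qed

lemma kconj_T_end: "kconj e mapT (-1) = -1" "kconj e mapTinv 1 = 1"
  by (simp_all add: kconj_def mapT_def mapTinv_def kinv_def)

lemma kconj_S:
  assumes "\<bar>x\<bar> \<le> 1"
  shows "kconj e mapS x = (if x < 0 then x + 1 else if x > 0 then x - 1 else e)"
proof (cases "\<bar>x\<bar> = 1")
  case True
  then show ?thesis by (auto simp: kconj_def kinv_def mapS_def kmap_def)
next
  case False
  with assms have "\<bar>x\<bar> < 1" by simp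
  then show ?thesis
    by (auto simp: kconj_def kinv_def mapS_def kmap_def abs_if field_simps)
qed

lemma ftilde_explicit:
  assumes "\<bar>x\<bar> \<le> 1"
  shows "ftilde e a b x =
    (if x < kmap a then kconj e mapT x
     else if x < kmap b then kconj e mapS x
     else kconj e mapTinv x)"
proof (cases "\<bar>x\<bar> = 1")
  case True
  have "- 1 < kmap a" "kmap a < 1" "kmap b < 1"
    using abs_kmap_less_1[of a] abs_kmap_less_1[of b] by auto
  with True show ?thesis
    by (auto simp: abs_if ftilde_def kconj_def fab_def kinv_def mapT_def mapTinv_def
        split: if_splits)
next
  case False
  with assms have x: "\<bar>x\<bar> < 1" by simp
  define y where "y = x / (1 - \<bar>x\<bar>)"
  have xy: "x = kmap y" and "kinv x = Some y"
    using kmap_kinv[OF x] x by (auto simp: y_def kinv_def)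
  then show ?thesis
    using strict_mono_less[OF kmap_strict_mono]
    by (simp add: ftilde_def kconj_def fab_def)
qed

lemma ftilde_in_interval:
  assumes "e \<in> {-1, 1}" "x \<in> {-1..1}"
  shows "ftilde e a b x \<in> {-1..1}"
proof -
  have "\<bar>kmap y\<bar> \<le> 1" for y
    using abs_kmap_less_1[of y] by simp
  with assms show ?thesis
    by (auto simp: ftilde_def kconj_def abs_le_iff minus_le_iff split: option.splits)
qed

end

theory Submission
  imports Defs
begin

text \<open>
  On the square, all translation and inversion branches of the maps are linearized
  simultaneously: there is one odd homeomorphism \<open>\<psi>\<close> of \<open>[-1,1]\<close>, of Minkowski question mark type
  and independent of \<open>a\<close> and \<open>b\<close>, that conjugates each of the branches to a map of slope
  \<open>\<phi> = (1 + \<surd>5) / 2\<close>. A map of constant slope \<open>\<phi>\<close> has laps of \<open>\<psi>\<close>-length at most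
  \<open>2 \<phi>\<^sup>-\<^sup>n\<close> for its \<open>n\<close>-th iterate, even if a lap contains upward jumps, so there are at least
  about \<open>\<phi>\<^sup>n\<close> of them. For the upper bound, the number of break points of the
  \<open>n\<close>-th iterate is shown to be \<open>O(\<phi>\<^sup>n)\<close>, using \<open>2 < \<phi>\<^sup>2\<close>.
\<close>

section \<open>Counting laps of maps of constant slope\<close>

text \<open>Counting the elements of \<open>D\<close> below a point is strictly increasing along the
  points of \<open>A\<close> outside \<open>D\<close>, hence injective with at most
  \<open>card D + 1\<close> values. Points of \<open>A\<close> inside \<open>D\<close> add at most
  \<open>card D\<close> more.\<close>

lemma
  fixes A D :: "real set"
  assumes "finite D" and sep: "\<And>x y. x \<in> A \<Longrightarrow> y \<in> A \<Longrightarrow> x < y \<Longrightarrow> {x..y} \<inter> D \<noteq> {}"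
  shows finite_separated: "finite A"
    and card_separated_disjoint: "A \<inter> D = {} \<Longrightarrow> card A \<le> card D + 1"
    and card_separated: "card A \<le> 2 * card D + 1"
proof -
  have *: "finite B \<and> card B \<le> card D + 1" if "B \<subseteq> A" "B \<inter> D = {}" for B
  proof -
    let ?c = "\<lambda>x. card {d \<in> D. d < x}"
    have less: "?c x < ?c y" if xy: "x \<in> B" "y \<in> B" "x < y" for x y
    proof -
      obtain d where "d \<in> D" "x \<le> d" "d \<le> y"
        using sep[of x y] xy subsetD[OF \<open>B \<subseteq> A\<close>] by (meson Int_iff atLeastAtMost_iff ex_in_conv)
      moreover have "d \<noteq> y" using \<open>B \<inter> D = {}\<close> \<open>d \<in> D\<close> that by auto
      ultimately have "d \<in> {d \<in> D. d < y}" "d \<notin> {d \<in> D. d < x}" by auto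
      then have "{d \<in> D. d < x} \<subset> {d \<in> D. d < y}"
        using \<open>x < y\<close> by force
      then show ?thesis using \<open>finite D\<close> by (intro psubset_card_mono) auto
    qed
    have inj: "inj_on ?c B"
      by (rule linorder_inj_onI') (drule (2) less, simp)
    moreover have im: "?c ` B \<subseteq> {..card D}"
      using \<open>finite D\<close> by (auto intro!: card_mono)
    ultimately show ?thesis
      using card_inj_on_le[OF inj im] inj_on_finite[OF inj im] by simp
  qed
  show "card A \<le> card D + 1" if "A \<inter> D = {}" using *[of A] that by simp
  have A: "A = (A - D) \<union> (A \<inter> D)" by auto
  have 1: "finite (A - D)" "card (A - D) \<le> card D + 1" using *[of "A - D"] by auto
  have 2: "finite (A \<inter> D)" "card (A \<inter> D) \<le> card D"
    using \<open>finite D\<close> by (auto intro: card_mono)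
  show "finite A" by (subst A) (intro finite_UnI 1 2)
  have "card A \<le> card (A - D) + card (A \<inter> D)"
    using card_Un_le[of "A - D" "A \<inter> D"] A by simp
  then show "card A \<le> 2 * card D + 1" using 1 2 by simp
qed

text \<open>A common point \<open>z\<close> links the two pieces: either it lies between the points
  to be compared, or one of the intervals contains both of them.\<close>

lemma mono_on_Un_interval:
  fixes f :: "real \<Rightarrow> 'a::order"
  assumes "is_interval J" "is_interval K" "mono_on J f" "mono_on K f" "J \<inter> K \<noteq> {}"
  shows "mono_on (J \<union> K) f"
proof -
  obtain z where z: "z \<in> J" "z \<in> K" using assms by auto
  have aux: "f u \<le> f v"
    if "is_interval J" "is_interval K" "mono_on J f" "mono_on K f" "z \<in> J" "z \<in> K"
      "u \<in> J" "v \<in> K" "u \<le> v" for u v and J K :: "real set"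
  proof -
    consider "u \<le> z" "z \<le> v" | "z < u" | "v < z" by linarith
    then show ?thesis
    proof cases
      case 1
      then show ?thesis using that by (meson mono_onD order_trans)
    next
      case 2
      then have "u \<in> K" using that by (metis is_interval_1 less_imp_le)
      then show ?thesis using that by (meson mono_onD)
    next
      case 3
      then have "v \<in> J" using that by (metis is_interval_1 less_imp_le)
      then show ?thesis using that by (meson mono_onD)
    qed
  qed
  show ?thesis
  proof (rule mono_onI)
    fix u v assume "u \<in> J \<union> K" "v \<in> J \<union> K" "u \<le> v"
    then consider "u \<in> J" "v \<in> J" | "u \<in> K" "v \<in> K" | "u \<in> J" "v \<in> K" | "u \<in> K" "v \<in> J"
      by blast
    then show "f u \<le> f v"
    proof cases
      case 1
      then show ?thesis using mono_onD[OF assms(3)] \<open>u \<le> v\<close> by simp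
    next
      case 2
      then show ?thesis using mono_onD[OF assms(4)] \<open>u \<le> v\<close> by simp
    next
      case 3
      then show ?thesis using aux[OF assms(1-4) z] \<open>u \<le> v\<close> by simp
    next
      case 4
      then show ?thesis using aux[OF assms(2,1,4,3) z(2,1)] \<open>u \<le> v\<close> by simp
    qed
  qed
qed

lemma is_interval_Un_real:
  fixes J K :: "real set"
  assumes "is_interval J" "is_interval K" "J \<inter> K \<noteq> {}"
  shows "is_interval (J \<union> K)"
  using assms by (simp add: is_interval_connected_1 connected_Un)

lemma is_interval_Icc_subset:
  fixes J :: "real set"
  shows "is_interval J \<Longrightarrow> x \<in> J \<Longrightarrow> y \<in> J \<Longrightarrow> {x..y} \<subseteq> J"
  unfolding is_interval_1 by (meson atLeastAtMost_iff subsetI)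

text \<open>After taking logarithms the constants contribute only \<open>ln A / n\<close> and
  \<open>ln B / n\<close>, which tend to 0.\<close>

lemma exponential_growth_rate:
  fixes c :: "nat \<Rightarrow> real"
  assumes "0 < l" "0 < A" and low: "\<And>n. A * l ^ n \<le> c n" and up: "\<And>n. c n \<le> B * l ^ n"
  shows "(\<lambda>n. 1 / real n * ln (c n)) \<longlonglongrightarrow> ln l"
proof -
  have pos: "0 < c n" for n using low[of n] assms by (smt (verit) zero_less_power mult_pos_pos)
  have "0 < B" using low[of 0] up[of 0] \<open>0 < A\<close> by simp
  have lim: "(\<lambda>n. 1 / real n * (ln C + real n * ln l)) \<longlonglongrightarrow> ln l" for C
  proof -
    have "(\<lambda>n. ln C / real n + ln l) \<longlonglongrightarrow> 0 + ln l"
      by (intro tendsto_add tendsto_const lim_const_over_n)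
    moreover have "\<forall>\<^sub>F n in sequentially. ln C / real n + ln l = 1 / real n * (ln C + real n * ln l)"
      using eventually_gt_at_top[of 0] by eventually_elim (auto simp: field_simps)
    ultimately show ?thesis using Lim_transform_eventually by fastforce
  qed
  show ?thesis
  proof (rule tendsto_sandwich[OF _ _ lim[of A] lim[of B]])
    have "ln A + real n * ln l \<le> ln (c n)" for n
    proof -
      have "ln (A * l ^ n) \<le> ln (c n)" using low[of n] pos[of n] assms by simp
      then show ?thesis using assms by (simp add: ln_mult ln_realpow)
    qed
    then show "\<forall>\<^sub>F n in sequentially. 1 / real n * (ln A + real n * ln l) \<le> 1 / real n * ln (c n)"
      by (intro always_eventually allI mult_left_mono) auto
    have "ln (c n) \<le> ln B + real n * ln l" for n
    proof -
      have "ln (c n) \<le> ln (B * l ^ n)" using up[of n] pos[of n] assms \<open>0 < B\<close> by simp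
      then show ?thesis using assms \<open>0 < B\<close> by (simp add: ln_mult ln_realpow)
    qed
    then show "\<forall>\<^sub>F n in sequentially. 1 / real n * ln (c n) \<le> 1 / real n * (ln B + real n * ln l)"
      by (intro always_eventually allI mult_left_mono) auto
  qed
qed

section \<open>Iterates of a map of constant slope\<close>

text \<open>In the coordinate \<psi> the map is affine with positive slope between points of
  \<open>D\<close>. Only intervals that avoid \<open>D\<close> are constrained, so \<open>D\<close>
  absorbs jumps and the ambiguous value at an interior point sent to infinity.\<close>

locale constant_slope =
  fixes F \<psi> :: "real \<Rightarrow> real" and slope :: real and D :: "real set"
  assumes slope: "1 < slope"
    and finite_D: "finite D"
    and F_in: "x \<in> {-1..1} \<Longrightarrow> F x \<in> {-1..1}"
    and \<psi>_cont: "continuous_on {-1..1} \<psi>"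
    and \<psi>_strict: "strict_mono_on {-1..1} \<psi>"
    and \<psi>_ends: "\<psi> (-1) = -1" "\<psi> 1 = 1"
    and scaling: "-1 \<le> x \<Longrightarrow> x \<le> y \<Longrightarrow> y \<le> 1 \<Longrightarrow> {x..y} \<inter> D = {} \<Longrightarrow>
      \<psi> (F y) - \<psi> (F x) = slope * (\<psi> y - \<psi> x)"
begin

text \<open>Every discontinuity of the \<open>n\<close>-th iterate is among these points, but such a
  point need not end a lap: an upward jump continues it.\<close>

definition breaks :: "nat \<Rightarrow> real set" where
  "breaks n = {x \<in> {-1..1}. \<exists>j<n. (F ^^ j) x \<in> D}"

lemma breaks_mono: "m \<le> n \<Longrightarrow> breaks m \<subseteq> breaks n"
  by (auto simp: breaks_def intro: less_le_trans)

lemma funpow_in: "x \<in> {-1..1} \<Longrightarrow> (F ^^ n) x \<in> {-1..1}"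
proof (induction n)
  case (Suc n)
  then show ?case using F_in[of "(F ^^ n) x"] by simp
qed simp

lemma \<psi>_less_iff: "x \<in> {-1..1} \<Longrightarrow> y \<in> {-1..1} \<Longrightarrow> \<psi> x < \<psi> y \<longleftrightarrow> x < y"
  using \<psi>_strict by (rule strict_mono_on_less)

lemma \<psi>_le_iff: "x \<in> {-1..1} \<Longrightarrow> y \<in> {-1..1} \<Longrightarrow> \<psi> x \<le> \<psi> y \<longleftrightarrow> x \<le> y"
  using \<psi>_less_iff by (meson not_le)

lemma \<psi>_eq_iff: "x \<in> {-1..1} \<Longrightarrow> y \<in> {-1..1} \<Longrightarrow> \<psi> x = \<psi> y \<longleftrightarrow> x = y"
  using \<psi>_less_iff by (metis less_irrefl linorder_less_linear)

lemma \<psi>_in: "x \<in> {-1..1} \<Longrightarrow> \<psi> x \<in> {-1..1}"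
  using \<psi>_le_iff[of "-1" x] \<psi>_le_iff[of x 1] \<psi>_ends by auto

lemma \<psi>_IVT:
  assumes "-1 \<le> x" "x \<le> y" "y \<le> 1" "\<psi> x \<le> v" "v \<le> \<psi> y"
  obtains t where "x \<le> t" "t \<le> y" "\<psi> t = v"
proof -
  have "continuous_on {x..y} \<psi>" using \<psi>_cont by (rule continuous_on_subset) (use assms in auto)
  from IVT'[OF assms(4,5,2) this] that show thesis by auto
qed

text \<open>In the induction step the interval between the two images has to miss \<open>D\<close>.
  By the intermediate value theorem for \<psi>, a point of \<open>D\<close> in it would be the image
  of some \<open>t\<close> between \<open>x\<close> and \<open>y\<close>, and this \<open>t\<close>
  would be a break point.\<close>

lemma scaling_funpow:
  assumes "-1 \<le> x" "x \<le> y" "y \<le> 1" "{x..y} \<inter> breaks n = {}"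
  shows "\<psi> ((F ^^ n) y) - \<psi> ((F ^^ n) x) = slope ^ n * (\<psi> y - \<psi> x)"
  using assms
proof (induction n arbitrary: x y)
  case (Suc n)
  have br: "{x..y} \<inter> breaks n = {}" using Suc.prems breaks_mono[of n "Suc n"] by auto
  have eq: "\<psi> ((F ^^ n) t) = \<psi> ((F ^^ n) x) + slope ^ n * (\<psi> t - \<psi> x)"
    if "x \<le> t" "t \<le> y" for t
  proof -
    have "{x..t} \<inter> breaks n = {}" using br that by fastforce
    then show ?thesis using Suc.IH[of x t] Suc.prems that by simp
  qed
  have pos: "0 < slope ^ n" using slope by simp
  have xy: "x \<in> {-1..1}" "y \<in> {-1..1}" using Suc.prems by auto
  have "\<psi> x \<le> \<psi> y" using \<psi>_le_iff xy Suc.prems by simp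
  then have "\<psi> ((F ^^ n) x) \<le> \<psi> ((F ^^ n) y)" using eq[of y] Suc.prems pos by simp
  then have le: "(F ^^ n) x \<le> (F ^^ n) y" using \<psi>_le_iff funpow_in xy by blast
  have "{(F ^^ n) x..(F ^^ n) y} \<inter> D = {}"
  proof (rule ccontr)
    assume "\<not> ?thesis"
    then obtain d where d: "d \<in> D" "(F ^^ n) x \<le> d" "d \<le> (F ^^ n) y" by auto
    have dI: "d \<in> {-1..1}" using d funpow_in[OF xy(1), of n] funpow_in[OF xy(2), of n] by auto
    have 1: "\<psi> ((F ^^ n) x) \<le> \<psi> d" "\<psi> d \<le> \<psi> ((F ^^ n) y)"
      using d dI \<psi>_le_iff funpow_in xy by blast+
    \<comment> \<open>The \<psi>-value of the sought preimage of \<open>d\<close>, found by solving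
      the affine relation \<open>eq\<close>.\<close>
    define v where "v = \<psi> x + (\<psi> d - \<psi> ((F ^^ n) x)) / slope ^ n"
    have "\<psi> x \<le> v" using 1 pos by (simp add: v_def)
    moreover have "\<psi> d - \<psi> ((F ^^ n) x) \<le> slope ^ n * (\<psi> y - \<psi> x)"
      using 1 eq[of y] Suc.prems by simp
    then have "(\<psi> d - \<psi> ((F ^^ n) x)) / slope ^ n \<le> \<psi> y - \<psi> x"
      using pos by (simp add: pos_divide_le_eq mult.commute)
    then have "v \<le> \<psi> y" by (simp add: v_def)
    ultimately obtain t where t: "x \<le> t" "t \<le> y" "\<psi> t = v"
      using \<psi>_IVT Suc.prems by metis
    have "\<psi> ((F ^^ n) t) = \<psi> d" using eq[of t] t slope by (simp add: v_def)
    moreover have tI: "t \<in> {-1..1}" using t xy by auto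
    ultimately have "(F ^^ n) t = d" using \<psi>_eq_iff dI funpow_in by blast
    then have "t \<in> breaks (Suc n)" using d tI by (auto simp: breaks_def)
    then show False using t Suc.prems by auto
  qed
  with scaling[of "(F ^^ n) x" "(F ^^ n) y"] le funpow_in[OF xy(1), of n] funpow_in[OF xy(2), of n]
  have "\<psi> ((F ^^ Suc n) y) - \<psi> ((F ^^ Suc n) x) = slope * (\<psi> ((F ^^ n) y) - \<psi> ((F ^^ n) x))"
    by simp
  then show ?case using eq[of y] Suc.prems by simp
qed simp

lemma funpow_strict:
  assumes "-1 \<le> x" "x < y" "y \<le> 1" "{x..y} \<inter> breaks n = {}"
  shows "(F ^^ n) x < (F ^^ n) y"
proof -
  have xy: "x \<in> {-1..1}" "y \<in> {-1..1}" using assms by auto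
  have "0 < slope ^ n * (\<psi> y - \<psi> x)"
    using slope assms \<psi>_less_iff xy by simp
  then have "\<psi> ((F ^^ n) x) < \<psi> ((F ^^ n) y)"
    using scaling_funpow[of x y n] assms by simp
  then show ?thesis using \<psi>_less_iff funpow_in xy by blast
qed

text \<open>Two points of one fibre are separated by a point of \<open>D\<close>, because scaling by
  a positive factor excludes equal values.\<close>

lemma finite_vimage_F:
  assumes "finite Q"
  shows "finite {x \<in> {-1..1}. F x \<in> Q}"
proof -
  have "finite {x \<in> {-1..1}. F x = c}" for c
  proof (rule finite_separated[OF finite_D])
    fix x y assume *: "x \<in> {x \<in> {-1..1}. F x = c}" "y \<in> {x \<in> {-1..1}. F x = c}" "x < y"
    show "{x..y} \<inter> D \<noteq> {}"
    proof
      assume "{x..y} \<inter> D = {}"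
      then have "slope * (\<psi> y - \<psi> x) = 0" using scaling[of x y] * by simp
      then show False using slope * \<psi>_less_iff[of x y] by simp
    qed
  qed
  moreover have "{x \<in> {-1..1}. F x \<in> Q} = (\<Union>c\<in>Q. {x \<in> {-1..1}. F x = c})" by auto
  ultimately show ?thesis using assms by simp
qed

lemma finite_breaks: "finite (breaks n)"
proof -
  have "finite {x \<in> {-1..1}. (F ^^ j) x \<in> D}" for j
  proof (induction j)
    case 0
    then show ?case using finite_D by simp
  next
    case (Suc j)
    have "(F ^^ Suc j) x = (F ^^ j) (F x)" for x by (simp add: funpow_swap1)
    then have "{x \<in> {-1..1}. (F ^^ Suc j) x \<in> D} =
        {x \<in> {-1..1}. F x \<in> {x \<in> {-1..1}. (F ^^ j) x \<in> D}}"
      using F_in by (auto simp del: funpow.simps atLeastAtMost_iff)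
    then show ?case using finite_vimage_F[OF Suc] by simp
  qed
  moreover have "breaks n = (\<Union>j\<in>{..<n}. {x \<in> {-1..1}. (F ^^ j) x \<in> D})"
    by (auto simp: breaks_def)
  ultimately show ?thesis by simp
qed

section \<open>Upper bound for the number of break points\<close>

text \<open>Half-open cells of length \<open>s\<close> in the \<psi>-coordinate contain at most one
  point each, and \<psi> ranges over an interval of length 2. The summand 2 pays for
  rounding.\<close>

lemma card_spaced:
  assumes "0 < s" "A \<subseteq> {-1..1}"
    and sep: "\<And>x y. x \<in> A \<Longrightarrow> y \<in> A \<Longrightarrow> x < y \<Longrightarrow> s \<le> \<psi> y - \<psi> x"
  shows "real (card A) \<le> 2 / s + 2"
proof -
  let ?c = "\<lambda>x. \<lfloor>\<psi> x / s\<rfloor>"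
  have less: "?c x < ?c y" if "x \<in> A" "y \<in> A" "x < y" for x y
  proof -
    have "(\<psi> x + s) / s \<le> \<psi> y / s" using sep[OF that] \<open>0 < s\<close> by (intro divide_right_mono) auto
    then have "\<psi> x / s + 1 \<le> \<psi> y / s" using \<open>0 < s\<close> by (simp add: add_divide_distrib)
    then show ?thesis by linarith
  qed
  have inj: "inj_on ?c A"
    by (rule linorder_inj_onI') (drule (2) less, simp)
  have im: "?c ` A \<subseteq> {\<lfloor>- 1 / s\<rfloor>..\<lfloor>1 / s\<rfloor>}"
  proof (clarsimp, intro conjI)
    fix x assume "x \<in> A"
    then have "-1 \<le> \<psi> x" "\<psi> x \<le> 1" using \<psi>_in[of x] \<open>A \<subseteq> {-1..1}\<close> by auto
    then have "- 1 / s \<le> \<psi> x / s" "\<psi> x / s \<le> 1 / s"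
      using \<open>0 < s\<close> by (auto intro: divide_right_mono simp del: divide_minus_left)
    then show "\<lfloor>- (1 / s)\<rfloor> \<le> \<lfloor>\<psi> x / s\<rfloor>" "\<lfloor>\<psi> x / s\<rfloor> \<le> \<lfloor>1 / s\<rfloor>" by (auto intro: floor_mono)
  qed
  have "card A \<le> nat (\<lfloor>1 / s\<rfloor> + 1 - \<lfloor>- 1 / s\<rfloor>)" using card_inj_on_le[OF inj im] by simp
  moreover have "\<lfloor>- 1 / s\<rfloor> \<le> \<lfloor>1 / s\<rfloor>" using \<open>0 < s\<close> by (intro floor_mono divide_right_mono) auto
  ultimately have "real (card A) \<le> of_int (\<lfloor>1 / s\<rfloor> + 1 - \<lfloor>- 1 / s\<rfloor>)" by linarith
  also have "\<dots> \<le> 1 / s + 1 + (1 / s + 1)" by linarith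
  finally show ?thesis by simp
qed

text \<open>
  Two new break points between neighbouring points of \<open>breaks n\<close> are at a \<open>\<psi>\<close>-distance of at
  least a constant times \<open>slope\<^sup>-\<^sup>n\<close>, so apart from \<open>O(slope\<^sup>n)\<close> of them there is at most one
  between any two neighbours. Taking two iterates at a time makes the resulting factor \<open>2\<close>
  smaller than the growth \<open>slope\<^sup>2\<close> per step.
\<close>

lemma card_breaks_add_2:
  "\<exists>C. \<forall>n. real (card (breaks (n + 2))) \<le> 2 * real (card (breaks n)) + C * slope ^ n"
proof -
  obtain \<delta> where \<delta>: "0 < \<delta>" "\<And>u v. u \<in> breaks 2 \<Longrightarrow> v \<in> breaks 2 \<Longrightarrow> u < v \<Longrightarrow> \<delta> \<le> \<psi> v - \<psi> u"
  proof -
    let ?S = "{\<psi> v - \<psi> u | u v. u \<in> breaks 2 \<and> v \<in> breaks 2 \<and> u < v}"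
    have "finite ((\<lambda>(u, v). \<psi> v - \<psi> u) ` (breaks 2 \<times> breaks 2))" using finite_breaks by simp
    \<comment> \<open>The inserted 1 guarantees a minimum even if \<open>breaks 2\<close> has fewer
      than two points.\<close>
    then have fin: "finite (insert 1 ?S)" by (rule rev_finite_subset[OF finite.insertI]) auto
    have pos: "0 < x" if "x \<in> insert 1 ?S" for x
    proof -
      have "0 < \<psi> v - \<psi> u" if "u \<in> breaks 2" "v \<in> breaks 2" "u < v" for u v
        using \<psi>_less_iff[of u v] that by (auto simp: breaks_def)
      then show ?thesis using that by auto
    qed
    show thesis
    proof
      show "0 < Min (insert 1 ?S)" using fin pos Min_in[OF fin] by blast
      show "Min (insert 1 ?S) \<le> \<psi> v - \<psi> u" if "u \<in> breaks 2" "v \<in> breaks 2" "u < v" for u v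
        using that fin by (intro Min_le) auto
    qed
  qed
  show ?thesis
  proof (intro exI allI)
    fix n
    \<comment> \<open>The gap \<delta> pulled back by the \<open>n\<close>-th iterate, which
      stretches \<psi>-lengths by \<open>slope ^ n\<close> between points of
      \<open>breaks n\<close>.\<close>
    define s where "s = \<delta> / slope ^ n"
    define N where "N = breaks (n + 2) - breaks n"
    have pos: "0 < slope ^ n" and s: "0 < s" using slope \<delta> by (auto simp: s_def)
    have NI: "N \<subseteq> {-1..1}" by (auto simp: N_def breaks_def)
    have N2: "(F ^^ n) x \<in> breaks 2" if x: "x \<in> N" for x
    proof -
      \<comment> \<open>A new break point first hits \<open>D\<close> at time \<open>n\<close> or
        \<open>n + 1\<close>, so its \<open>n\<close>-th image does so within two steps.\<close>
      obtain j where j: "j < n + 2" "(F ^^ j) x \<in> D" and "x \<in> {-1..1}" "\<not> j < n"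
        using x by (auto simp: N_def breaks_def)
      then have "(F ^^ (j - n)) ((F ^^ n) x) \<in> D" "j - n < 2"
        by (simp_all flip: funpow_add[THEN fun_cong, unfolded comp_def])
      then show ?thesis using funpow_in \<open>x \<in> {-1..1}\<close> by (auto simp: breaks_def)
    qed
    have far: "s \<le> \<psi> y - \<psi> x" if xy: "x \<in> N" "y \<in> N" "x < y" "{x..y} \<inter> breaks n = {}" for x y
    proof -
      have I: "-1 \<le> x" "y \<le> 1" using xy NI by auto
      have "\<delta> \<le> \<psi> ((F ^^ n) y) - \<psi> ((F ^^ n) x)"
        using \<delta>(2) N2 xy funpow_strict[of x y n] I by blast
      also have "\<dots> = slope ^ n * (\<psi> y - \<psi> x)" using scaling_funpow[of x y n] I xy by simp
      finally show ?thesis using pos by (simp add: s_def pos_divide_le_eq mult.commute)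
    qed
    \<comment> \<open>\<open>G\<close> is spaced by construction. A point \<open>x\<close> of
      \<open>N - G\<close> has a new point \<open>z\<close> close to its right. Another new point
      \<open>y > x\<close> in the same gap of \<open>breaks n\<close> is far from \<open>x\<close>,
      so \<open>z\<close> lies before \<open>y\<close>, hence in that gap too, against
      \<open>far\<close>.\<close>
    define G where "G = {x \<in> N. \<forall>y\<in>N. x < y \<longrightarrow> s \<le> \<psi> y - \<psi> x}"
    have G: "real (card G) \<le> 2 / s + 2"
      using NI by (intro card_spaced[OF s]) (auto simp: G_def)
    have H: "card (N - G) \<le> card (breaks n) + 1"
    proof (rule card_separated_disjoint[OF finite_breaks])
      show "(N - G) \<inter> breaks n = {}" by (auto simp: N_def)
      fix x y assume x: "x \<in> N - G" and y: "y \<in> N - G" and "x < y"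
      show "{x..y} \<inter> breaks n \<noteq> {}"
      proof
        assume e: "{x..y} \<inter> breaks n = {}"
        obtain z where z: "z \<in> N" "x < z" "\<psi> z - \<psi> x < s" using x by (auto simp: G_def not_le)
        have "\<psi> z < \<psi> y" using far[of x y] x y e z \<open>x < y\<close> by auto
        then have "z < y" using \<psi>_less_iff[of z y] NI z y by (simp add: subset_iff)
        then have "{x..z} \<inter> breaks n = {}" using e by fastforce
        then show False using far[of x z] x z by auto
      qed
    qed
    have "breaks (n + 2) = breaks n \<union> (G \<union> (N - G))"
      using breaks_mono[of n "n + 2"] by (auto simp: N_def G_def)
    then have "card (breaks (n + 2)) \<le> card (breaks n) + (card G + card (N - G))"
      using card_Un_le[of "breaks n" "G \<union> (N - G)"] card_Un_le[of G "N - G"] by simp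
    then have "real (card (breaks (n + 2))) \<le> 2 * real (card (breaks n)) + (2 / s + 3)"
      using G H by linarith
    also have "2 / s + 3 \<le> (2 / \<delta> + 3) * slope ^ n"
      using one_le_power[of slope n] slope by (simp add: s_def algebra_simps)
    finally show "real (card (breaks (n + 2))) \<le> 2 * real (card (breaks n)) + (2 / \<delta> + 3) * slope ^ n"
      by simp
  qed
qed

text \<open>Two steps double the count up to a term of order \<open>slope ^ n\<close>, while the
  bound grows by the larger factor \<open>slope\<^sup>2\<close>; a big enough constant absorbs the
  extra term.\<close>

lemma card_breaks_le:
  assumes "2 < slope\<^sup>2"
  obtains K where "0 \<le> K" "\<And>n. real (card (breaks n)) \<le> K * slope ^ n"
proof -
  from card_breaks_add_2 obtain C where
    C: "\<forall>n. real (card (breaks (n + 2))) \<le> 2 * real (card (breaks n)) + C * slope ^ n" ..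
  \<comment> \<open>The first two entries settle the base cases 0 and 1 of the two-step recursion,
    the third gives \<open>C + 2 * K \<le> K * slope\<^sup>2\<close>.\<close>
  define K where "K = Max {1, real (card (breaks 1)), C / (slope\<^sup>2 - 2)}"
  have K: "1 \<le> K" "real (card (breaks 1)) \<le> K" "C / (slope\<^sup>2 - 2) \<le> K" by (auto simp: K_def)
  have CK: "C + 2 * K \<le> K * slope\<^sup>2" using K(3) assms by (simp add: field_simps)
  have "real (card (breaks n)) \<le> K * slope ^ n" for n
  proof (induction n rule: less_induct)
    case (less n)
    consider "n = 0" | "n = 1" | m where "n = m + 2"
      by (metis One_nat_def add_2_eq_Suc' not0_implies_Suc)
    then show ?case
    proof cases
      case 1
      then show ?thesis using K by (simp add: breaks_def)
    next
      case 2
      have "K * 1 \<le> K * slope" using K slope by (intro mult_left_mono) auto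
      with 2 K(2) show ?thesis by (simp del: One_nat_def)
    next
      case 3
      have "real (card (breaks n)) \<le> 2 * (K * slope ^ m) + C * slope ^ m"
        using C[rule_format, of m] less.IH[of m] 3 by simp
      also have "\<dots> = (C + 2 * K) * slope ^ m" by (simp add: algebra_simps)
      also have "\<dots> \<le> (K * slope\<^sup>2) * slope ^ m" using CK slope by (intro mult_right_mono) auto
      also have "\<dots> = K * slope ^ n" using 3 by (simp add: power2_eq_square)
      finally show ?thesis .
    qed
  qed
  then show thesis using that K by (meson order_trans zero_le_one)
qed

section \<open>Laps and an upper bound for their number\<close>

text \<open>Every nondegenerate interval contains a smaller one free of break points, where the
  iterate increases strictly. So an interval on which it is antimonotone has at most one
  point.\<close>

lemma monotone_interval_funpow:
  assumes "J \<subseteq> {-1..1}"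
  shows "monotone_interval (F ^^ n) J \<longleftrightarrow> is_interval J \<and> mono_on J (F ^^ n)"
proof -
  have "mono_on J (F ^^ n)" if int: "is_interval J" and anti: "antimono_on J (F ^^ n)"
  proof -
    have False if xy: "x \<in> J" "y \<in> J" "x < y" for x y
    proof -
      have "infinite ({x<..<y} - breaks n)" using finite_breaks \<open>x < y\<close> by simp
      then obtain u where u: "u \<in> {x<..<y} - breaks n" by (metis ex_in_conv finite.emptyI)
      have "open ({x<..<y} - breaks n)"
        using finite_breaks by (intro open_Diff finite_imp_closed) auto
      then obtain \<epsilon> where \<epsilon>: "0 < \<epsilon>" "cball u \<epsilon> \<subseteq> {x<..<y} - breaks n"
        using u open_contains_cball by blast
      have sub: "{u..u + \<epsilon>} \<subseteq> {x<..<y} - breaks n"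
        using \<epsilon> by (auto simp: cball_def dist_real_def subset_iff)
      have "u \<in> {u..u + \<epsilon>}" "u + \<epsilon> \<in> {u..u + \<epsilon>}" using \<epsilon> by auto
      then have "u \<in> {x..y}" "u + \<epsilon> \<in> {x..y}" using sub by fastforce+
      then have uJ: "u \<in> J" "u + \<epsilon> \<in> J" using is_interval_Icc_subset[OF int xy(1,2)] by blast+
      then have "(F ^^ n) (u + \<epsilon>) \<le> (F ^^ n) u"
        using monotone_onD[OF anti, of u "u + \<epsilon>"] \<epsilon> by simp
      moreover have "(F ^^ n) u < (F ^^ n) (u + \<epsilon>)"
        using uJ assms \<epsilon> sub by (intro funpow_strict) auto
      ultimately show False by simp
    qed
    then show ?thesis by (metis less_le mono_onI order_refl)
  qed
  then show ?thesis by (auto simp: monotone_interval_def)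
qed

lemma laps_funpow:
  "laps {-1..1} (F ^^ n) = {J. J \<subseteq> {-1..1} \<and> is_interval J \<and> mono_on J (F ^^ n) \<and>
     (\<forall>J'. J \<subseteq> J' \<and> J' \<subseteq> {-1..1} \<and> is_interval J' \<and> mono_on J' (F ^^ n) \<longrightarrow> J' = J)}"
  by (simp add: laps_def monotone_interval_funpow cong: conj_cong)

lemma lapD:
  assumes "J \<in> laps {-1..1} (F ^^ n)"
  shows "J \<subseteq> {-1..1}" "is_interval J" "mono_on J (F ^^ n)"
    and "J \<subseteq> J' \<Longrightarrow> J' \<subseteq> {-1..1} \<Longrightarrow> is_interval J' \<Longrightarrow> mono_on J' (F ^^ n) \<Longrightarrow> J' = J"
  using assms by (simp_all add: laps_funpow)

text \<open>The union of overlapping laps is again an increasing interval, so by maximality both are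
  equal to it.\<close>

lemma laps_eqI:
  assumes J: "J \<in> laps {-1..1} (F ^^ n)" and K: "K \<in> laps {-1..1} (F ^^ n)" and "J \<inter> K \<noteq> {}"
  shows "J = K"
proof -
  have "is_interval (J \<union> K)" "mono_on (J \<union> K) (F ^^ n)" "J \<union> K \<subseteq> {-1..1}"
    using lapD(1-3)[OF J] lapD(1-3)[OF K] assms(3)
    by (simp_all add: is_interval_Un_real mono_on_Un_interval)
  then have "J \<union> K = J" "J \<union> K = K"
    using lapD(4)[OF J, of "J \<union> K"] lapD(4)[OF K, of "J \<union> K"] by blast+
  then show ?thesis by blast
qed

text \<open>The lap is the union of all increasing intervals through \<open>x\<close>; as they share
  \<open>x\<close>, the union is again one.\<close>

lemma ex_lap:
  assumes x: "x \<in> {-1..1}"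
  obtains J where "J \<in> laps {-1..1} (F ^^ n)" "x \<in> J"
proof -
  define \<J> where "\<J> = {J. J \<subseteq> {-1..1} \<and> is_interval J \<and> mono_on J (F ^^ n) \<and> x \<in> J}"
  have "{x} \<in> \<J>" using x by (auto simp: \<J>_def is_interval_1 intro: mono_onI)
  have int: "is_interval (\<Union>\<J>)"
    unfolding is_interval_connected_1 by (rule connected_Union) (auto simp: \<J>_def is_interval_connected_1)
  have mono: "mono_on (\<Union>\<J>) (F ^^ n)"
  proof (rule mono_onI)
    fix u v assume "u \<in> \<Union>\<J>" "v \<in> \<Union>\<J>" "u \<le> v"
    then obtain J K where JK: "J \<in> \<J>" "K \<in> \<J>" "u \<in> J" "v \<in> K" by auto
    then have "mono_on (J \<union> K) (F ^^ n)" by (intro mono_on_Un_interval) (auto simp: \<J>_def)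
    then show "(F ^^ n) u \<le> (F ^^ n) v" using JK \<open>u \<le> v\<close> by (auto dest: mono_onD)
  qed
  have "\<Union>\<J> \<in> laps {-1..1} (F ^^ n)"
    unfolding laps_funpow
  proof (intro CollectI conjI allI impI)
    show "\<Union>\<J> \<subseteq> {-1..1}" unfolding \<J>_def by blast
    fix J' assume "\<Union>\<J> \<subseteq> J' \<and> J' \<subseteq> {-1..1} \<and> is_interval J' \<and> mono_on J' (F ^^ n)"
    moreover from this have "J' \<in> \<J>" using \<open>{x} \<in> \<J>\<close> unfolding \<J>_def by blast
    ultimately show "J' = \<Union>\<J>" by blast
  qed (fact int mono)+
  then show thesis using \<open>{x} \<in> \<J>\<close> by (intro that[of "\<Union>\<J>"]) auto
qed

text \<open>The definition of \<open>laps\<close> admits the empty interval as a candidate, but it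
  lies inside the lap of 0 and so is not maximal.\<close>

lemma laps_nonempty:
  assumes "J \<in> laps {-1..1} (F ^^ n)"
  shows "J \<noteq> {}"
proof
  assume "J = {}"
  obtain K where K: "K \<in> laps {-1..1} (F ^^ n)" "0 \<in> K" using ex_lap[of 0 n] by auto
  then have "K = J" using lapD(1-3)[OF K(1)] lapD(4)[OF assms] \<open>J = {}\<close> by simp
  then show False using K \<open>J = {}\<close> by simp
qed

text \<open>One point is chosen in each lap. Without a break point between two chosen points the
  iterate would increase from one to the other, and the first lap would extend to meet the second. A
  chosen point may itself be a break point, hence the factor 2.\<close>

lemma
  shows finite_laps: "finite (laps {-1..1} (F ^^ n))"
    and card_laps_le: "card (laps {-1..1} (F ^^ n)) \<le> 2 * card (breaks n) + 1"
proof -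
  define c where "c = (\<lambda>J::real set. SOME x. x \<in> J)"
  have c: "c J \<in> J" if "J \<in> laps {-1..1} (F ^^ n)" for J
    using laps_nonempty[OF that] by (auto simp: c_def some_in_eq)
  let ?L = "laps {-1..1} (F ^^ n)"
  have inj: "inj_on c ?L"
  proof (rule inj_onI)
    fix J K assume "J \<in> ?L" "K \<in> ?L" "c J = c K"
    moreover from this have "c J \<in> J \<inter> K" using c[of J] c[of K] by simp
    ultimately show "J = K" using laps_eqI by blast
  qed
  have sep: "{x..y} \<inter> breaks n \<noteq> {}" if xy: "x \<in> c ` ?L" "y \<in> c ` ?L" "x < y" for x y
  proof
    assume e: "{x..y} \<inter> breaks n = {}"
    obtain J K where J: "J \<in> ?L" "x \<in> J" and K: "K \<in> ?L" "y \<in> K" "x = c J" "y = c K"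
      using xy c by blast
    have JK: "J \<subseteq> {-1..1}" "is_interval J" "mono_on J (F ^^ n)"
       "K \<subseteq> {-1..1}" "is_interval K" "mono_on K (F ^^ n)"
      using lapD(1-3)[OF J(1)] lapD(1-3)[OF K(1)] by auto
    then have I: "-1 \<le> x" "y \<le> 1" using J K by auto
    have "mono_on {x..y} (F ^^ n)"
    proof (rule mono_onI)
      fix u v assume uv: "u \<in> {x..y}" "v \<in> {x..y}" "u \<le> v"
      then have "{u..v} \<subseteq> {x..y}" by simp
      then have "{u..v} \<inter> breaks n = {}" using e by blast
      then show "(F ^^ n) u \<le> (F ^^ n) v"
        using funpow_strict[of u v n] uv I by (cases "u = v") auto
    qed
    then have "mono_on (J \<union> {x..y}) (F ^^ n)" "is_interval (J \<union> {x..y})"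
      using JK J \<open>x < y\<close> by (auto intro!: mono_on_Un_interval is_interval_Un_real simp: is_interval_cc)
    moreover have "J \<union> {x..y} \<subseteq> {-1..1}" using JK I by auto
    ultimately have "J \<union> {x..y} = J" using lapD(4)[OF J(1), of "J \<union> {x..y}"] by simp
    moreover have "y \<in> J \<union> {x..y}" using \<open>x < y\<close> by simp
    ultimately have "y \<in> J \<inter> K" using K(2) by blast
    then have "J = K" using laps_eqI[OF J(1) K(1)] by blast
    then show False using K \<open>x < y\<close> by simp
  qed
  have "finite (c ` ?L)" using finite_breaks sep by (rule finite_separated)
  then show "finite ?L" using inj by (rule finite_imageD)
  have "card (c ` ?L) \<le> 2 * card (breaks n) + 1" using finite_breaks sep by (rule card_separated)
  then show "card ?L \<le> 2 * card (breaks n) + 1" using card_image[OF inj] by simp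
qed

section \<open>Lower bound for the number of laps\<close>

text \<open>Where the iterate is increasing, its jumps go upward and only add to the growth of
  \<psi>, so the equality of \<open>scaling_funpow\<close> survives as an inequality. Splitting at
  inner break points leaves the case where only the end points may be break points.\<close>

lemma expansion_mono:
  assumes "-1 \<le> x" "x < y" "y \<le> 1" "mono_on {x..y} (F ^^ n)"
  shows "slope ^ n * (\<psi> y - \<psi> x) \<le> \<psi> ((F ^^ n) y) - \<psi> ((F ^^ n) x)"
  using assms
proof (induction "card (breaks n \<inter> {x<..<y})" arbitrary: x y rule: less_induct)
  case less
  show ?case
  proof (cases "breaks n \<inter> {x<..<y} = {}")
    case False
    then obtain z where z: "z \<in> breaks n" "x < z" "z < y" by auto
    have "breaks n \<inter> {x<..<z} \<subset> breaks n \<inter> {x<..<y}" "breaks n \<inter> {z<..<y} \<subset> breaks n \<inter> {x<..<y}"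
      using z by auto
    then have "card (breaks n \<inter> {x<..<z}) < card (breaks n \<inter> {x<..<y})"
        "card (breaks n \<inter> {z<..<y}) < card (breaks n \<inter> {x<..<y})"
      using finite_breaks by (auto intro: psubset_card_mono)
    then have "slope ^ n * (\<psi> z - \<psi> x) \<le> \<psi> ((F ^^ n) z) - \<psi> ((F ^^ n) x)"
        "slope ^ n * (\<psi> y - \<psi> z) \<le> \<psi> ((F ^^ n) y) - \<psi> ((F ^^ n) z)"
      using less.prems z
      by (auto intro!: less.hyps intro: mono_on_subset)
    then show ?thesis by (simp add: algebra_simps)
  next
    case True
    have xy: "x \<in> {-1..1}" "y \<in> {-1..1}" using less.prems by auto
    have "\<psi> x < \<psi> y" using \<psi>_less_iff xy less.prems by simp
    \<comment> \<open>Scaling holds at inner points \<open>s\<close> and \<open>t\<close> with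
      \<psi>-values \<open>u\<close> and \<open>v\<close>, kept apart by \<open>m\<close>. First
      \<open>v\<close> and then \<open>u\<close> is moved to its end of the interval.\<close>
    define m where "m = (\<psi> x + \<psi> y) / 2"
    have key: "slope ^ n * (v - u) \<le> \<psi> ((F ^^ n) y) - \<psi> ((F ^^ n) x)"
      if uv: "\<psi> x < u" "u < m" "m < v" "v < \<psi> y" for u v
    proof -
      obtain s where s: "x \<le> s" "s \<le> y" "\<psi> s = u" using \<psi>_IVT[of x y u] less.prems uv by auto
      obtain t where t: "x \<le> t" "t \<le> y" "\<psi> t = v" using \<psi>_IVT[of x y v] less.prems uv by auto
      have st: "x < s" "s < t" "t < y" "s \<in> {-1..1}" "t \<in> {-1..1}"
        using s t uv \<psi>_less_iff[of s t] xy less_le by auto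
      have "{s..t} \<inter> breaks n = {}" using True st by auto
      then have "\<psi> ((F ^^ n) t) - \<psi> ((F ^^ n) s) = slope ^ n * (v - u)"
        using scaling_funpow[of s t n] st s t by auto
      moreover have "(F ^^ n) x \<le> (F ^^ n) s" "(F ^^ n) t \<le> (F ^^ n) y"
        using less.prems st by (auto intro: mono_onD)
      then have "\<psi> ((F ^^ n) x) \<le> \<psi> ((F ^^ n) s)" "\<psi> ((F ^^ n) t) \<le> \<psi> ((F ^^ n) y)"
        using \<psi>_le_iff funpow_in xy st by blast+
      ultimately show ?thesis by linarith
    qed
    have m: "\<psi> x < m" "m < \<psi> y" using \<open>\<psi> x < \<psi> y\<close> by (auto simp: m_def)
    have key2: "slope ^ n * (\<psi> y - u) \<le> \<psi> ((F ^^ n) y) - \<psi> ((F ^^ n) x)"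
      if u: "\<psi> x < u" "u < m" for u
    proof (rule tendsto_upperbound)
      show "((\<lambda>v. slope ^ n * (v - u)) \<longlongrightarrow> slope ^ n * (\<psi> y - u)) (at_left (\<psi> y))"
        by (intro tendsto_intros)
      show "\<forall>\<^sub>F v in at_left (\<psi> y). slope ^ n * (v - u) \<le> \<psi> ((F ^^ n) y) - \<psi> ((F ^^ n) x)"
        using eventually_at_left_real[OF m(2)] by eventually_elim (use key u in simp)
    qed simp
    show ?thesis
    proof (rule tendsto_upperbound)
      show "((\<lambda>u. slope ^ n * (\<psi> y - u)) \<longlongrightarrow> slope ^ n * (\<psi> y - \<psi> x)) (at_right (\<psi> x))"
        by (intro tendsto_intros)
      show "\<forall>\<^sub>F u in at_right (\<psi> x). slope ^ n * (\<psi> y - u) \<le> \<psi> ((F ^^ n) y) - \<psi> ((F ^^ n) x)"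
        using eventually_at_right_real[OF m(1)] by eventually_elim (use key2 in simp)
    qed simp
  qed
qed

text \<open>Sample points at \<psi>-distance \<open>3 / slope ^ n\<close> lie in different laps:
  within one lap the image would have \<psi>-length at least 3, but \<psi> ranges over an interval
  of length 2. This length has room for about \<open>2 / 3 * slope ^ n\<close> samples.\<close>

lemma card_laps_ge: "2 / 3 * slope ^ n \<le> real (card (laps {-1..1} (F ^^ n)))"
proof -
  define m where "m = nat \<lfloor>2 / 3 * slope ^ n\<rfloor>"
  have pos: "0 < slope ^ n" using slope by simp
  have m: "2 / 3 * slope ^ n < real m + 1" "real m \<le> 2 / 3 * slope ^ n"
    using pos floor_correct[of "2 / 3 * slope ^ n"] unfolding m_def by auto
  let ?v = "\<lambda>i::nat. -1 + real i * (3 / slope ^ n)"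
  have "\<exists>x \<in> {-1..1}. \<psi> x = ?v i" if "i \<le> m" for i
  proof -
    have "real i \<le> 2 / 3 * slope ^ n" using that m by linarith
    then have "?v i \<le> \<psi> 1" using pos \<psi>_ends by (simp add: field_simps)
    moreover have "\<psi> (-1) \<le> ?v i" using pos \<psi>_ends by simp
    ultimately show ?thesis using \<psi>_IVT[of "-1" 1 "?v i"] by fastforce
  qed
  then obtain p where p: "\<And>i. i \<le> m \<Longrightarrow> p i \<in> {-1..1} \<and> \<psi> (p i) = ?v i" by metis
  have "\<exists>J. J \<in> laps {-1..1} (F ^^ n) \<and> p i \<in> J" if "i \<le> m" for i
    using ex_lap p that by metis
  then obtain l where l: "\<And>i. i \<le> m \<Longrightarrow> l i \<in> laps {-1..1} (F ^^ n) \<and> p i \<in> l i" by metis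
  have less: "l i \<noteq> l j" if ij: "i \<le> m" "j \<le> m" "i < j" for i j
  proof
    assume eq: "l i = l j"
    have "1 * (3 / slope ^ n) \<le> (real j - real i) * (3 / slope ^ n)"
      using ij pos by (intro mult_right_mono) auto
    also have "\<dots> = \<psi> (p j) - \<psi> (p i)"
      using p[of i] p[of j] ij by (simp add: left_diff_distrib del: times_divide_eq_right)
    finally have d: "3 / slope ^ n \<le> \<psi> (p j) - \<psi> (p i)" by simp
    moreover have "0 < 3 / slope ^ n" using pos by simp
    ultimately have "\<psi> (p i) < \<psi> (p j)" by linarith
    then have lt: "p i < p j" using \<psi>_less_iff[of "p i" "p j"] p[of i] p[of j] ij by simp
    have "is_interval (l i)" "mono_on (l i) (F ^^ n)" "p i \<in> l i" "p j \<in> l i"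
      using lapD(2,3)[of "l i" n] l[of i] l[of j] ij eq by auto
    moreover from this have "{p i..p j} \<subseteq> l i" by (intro is_interval_Icc_subset)
    ultimately have "mono_on {p i..p j} (F ^^ n)" by (auto intro: mono_on_subset)
    then have "slope ^ n * (\<psi> (p j) - \<psi> (p i)) \<le> \<psi> ((F ^^ n) (p j)) - \<psi> ((F ^^ n) (p i))"
      using expansion_mono[of "p i" "p j" n] lt p[of i] p[of j] ij by auto
    also have "\<dots> \<le> 2"
      using \<psi>_in[OF funpow_in, of "p i" n] \<psi>_in[OF funpow_in, of "p j" n] p[of i] p[of j] ij by auto
    finally have "slope ^ n * (\<psi> (p j) - \<psi> (p i)) \<le> 2" .
    moreover have "3 \<le> slope ^ n * (\<psi> (p j) - \<psi> (p i))"
      using d pos by (simp only: pos_divide_le_eq mult.commute)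
    ultimately show False by simp
  qed
  have "inj_on l {..m}" by (rule linorder_inj_onI') (use less in blast)
  moreover have "l ` {..m} \<subseteq> laps {-1..1} (F ^^ n)" using l by auto
  ultimately have "m + 1 \<le> card (laps {-1..1} (F ^^ n))"
    using card_inj_on_le[OF _ _ finite_laps] by fastforce
  then show ?thesis using m by linarith
qed

theorem has_htop_slope:
  assumes "2 < slope\<^sup>2"
  shows "has_htop {-1..1} F (ln slope)"
proof -
  obtain K where K: "0 \<le> K" "\<And>n. real (card (breaks n)) \<le> K * slope ^ n"
    using card_breaks_le[OF assms] by blast
  have "real (card (laps {-1..1} (F ^^ n))) \<le> (2 * K + 1) * slope ^ n" for n
  proof -
    have "real (card (laps {-1..1} (F ^^ n))) \<le> 2 * real (card (breaks n)) + 1"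
      using card_laps_le[of n] by linarith
    also have "\<dots> \<le> 2 * (K * slope ^ n) + slope ^ n"
      using K(2)[of n] one_le_power[of slope n] slope by linarith
    finally show ?thesis by (simp add: algebra_simps)
  qed
  then show ?thesis
    unfolding has_htop_def using card_laps_ge slope
    by (intro exponential_growth_rate[where A = "2 / 3"]) auto
qed

end

section \<open>A conjugacy to constant slope\<close>

definition golden :: real where "golden = (1 + sqrt 5) / 2"

lemma golden_sq: "golden\<^sup>2 = golden + 1"
  by (simp add: golden_def power2_eq_square field_simps)

lemma golden_gt: "1.6 < golden"
proof -
  have "2.2 < sqrt 5" by (rule real_less_rsqrt) (simp add: power2_eq_square)
  then show ?thesis by (simp add: golden_def)
qed

lemma golden_less: "golden < 1.7"
proof -
  have "sqrt 5 < 2.4" by (rule real_less_lsqrt) (simp_all add: power2_eq_square)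
  then show ?thesis by (simp add: golden_def)
qed

text \<open>The reciprocal of \<open>golden\<close>, by \<open>golden_rho\<close>.\<close>

abbreviation rho :: real where "rho \<equiv> golden - 1"

lemma golden_rho: "golden * rho = 1"
  using golden_sq by (simp add: power2_eq_square algebra_simps)

lemma rho_bounds: "0 < rho" "rho < 1" "rho \<noteq> 0" "golden \<noteq> 0"
  using golden_gt golden_less by auto


lemma rho_sq: "rho * rho = 1 - rho"
  using golden_sq by (simp add: power2_eq_square algebra_simps)

text \<open>
  Fixed points are the odd functions \<open>\<psi>\<close> with \<open>\<psi> (S x) = -1 + \<phi> (\<psi> x)\<close> on \<open>(0, 1/2]\<close>, where
  \<open>S x = x - 1\<close>, and \<open>1 - \<psi> (T\<^sup>-\<^sup>1 x) = \<phi> (1 - \<psi> x)\<close> on \<open>[1/2, 1]\<close>, where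
  \<open>T\<^sup>-\<^sup>1 x = 2 - 1 / x\<close>.
\<close>

definition slope_op :: "(real \<Rightarrow> real) \<Rightarrow> real \<Rightarrow> real" where
  "slope_op h y = (if y \<le> 1/2 then rho * (1 - h (1 - y)) else 1 - rho * (1 - h (2 - 1 / y)))"

text \<open>At 1/2 the branches of \<open>slope_op h\<close> give \<open>rho * (1 - h (1/2))\<close>
  and \<open>1 - rho * (1 - h 0)\<close>. With the prescribed values they agree because
  \<open>rho * rho = 1 - rho\<close>, which is where the golden ratio enters.\<close>

definition admissible :: "(real \<Rightarrow> real) \<Rightarrow> bool" where
  "admissible h \<longleftrightarrow> continuous_on {0..1} h \<and> mono_on {0..1} h \<and> h 0 = 0 \<and> h (1/2) = 1 - rho \<and> h 1 = 1"

lemma admissible_bounds: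
  assumes "admissible h" "y \<in> {0..1}"
  shows "0 \<le> h y" "h y \<le> 1"
  using assms mono_onD[of "{0..1}" h 0 y] mono_onD[of "{0..1}" h y 1]
  by (auto simp: admissible_def)

lemma right_branch_bounds:
  fixes y :: real
  assumes "1/2 \<le> y" "y \<le> 1"
  shows "0 \<le> 2 - 1 / y" "2 - 1 / y \<le> 1"
  using assms by (auto simp: field_simps)

lemma admissible_slope_op:
  assumes h: "admissible h"
  shows "admissible (slope_op h)"
proof -
  have cont: "continuous_on {0..1} h" and mono: "mono_on {0..1} h"
    and v: "h 0 = 0" "h (1/2) = 1 - rho" "h 1 = 1" using h by (auto simp: admissible_def)
  have glue: "slope_op h y = 1 - rho * (1 - h (2 - 1 / y))" if "y = 1/2" for y
    unfolding that using rho_sq by (simp add: slope_op_def v algebra_simps)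
  have val: "slope_op h 0 = 0" "slope_op h (1/2) = 1 - rho" "slope_op h 1 = 1"
    using v rho_sq by (auto simp: slope_op_def)
  have c1: "continuous_on {0..1/2} (\<lambda>y. rho * (1 - h (1 - y)))"
    by (intro continuous_intros continuous_on_compose2[OF cont]) auto
  have c2: "continuous_on {1/2..1} (\<lambda>y. 1 - rho * (1 - h (2 - 1 / y)))"
    by (intro continuous_intros continuous_on_compose2[OF cont])
       (use right_branch_bounds in \<open>auto\<close>)
  have "continuous_on ({0..1/2} \<union> {1/2..1}) (slope_op h)"
  proof (rule continuous_on_closed_Un)
    show "continuous_on {0..1/2} (slope_op h)"
      using c1 by (rule continuous_on_eq) (auto simp: slope_op_def)
    show "continuous_on {1/2..1} (slope_op h)"
      using c2 by (rule continuous_on_eq) (use glue in \<open>auto simp: slope_op_def\<close>)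
  qed auto
  moreover have "{0..1/2} \<union> {1/2..1} = {0..1::real}" by auto
  ultimately have cont': "continuous_on {0..1} (slope_op h)" by simp
  have left: "slope_op h x \<le> slope_op h y" if "0 \<le> x" "x \<le> y" "y \<le> 1/2" for x y
    using that rho_bounds mono_onD[OF mono, of "1 - y" "1 - x"]
    by (auto simp: slope_op_def intro!: mult_left_mono)
  have right: "slope_op h x \<le> slope_op h y" if xy: "1/2 \<le> x" "x \<le> y" "y \<le> 1" for x y
  proof -
    have "2 - 1 / x \<le> 2 - 1 / y" using xy by (auto simp: frac_le)
    then have "h (2 - 1 / x) \<le> h (2 - 1 / y)"
      using mono_onD[OF mono, of "2 - 1 / x" "2 - 1 / y"] right_branch_bounds xy by auto
    then have "1 - rho * (1 - h (2 - 1 / x)) \<le> 1 - rho * (1 - h (2 - 1 / y))"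
      using rho_bounds by simp
    moreover have "slope_op h z = 1 - rho * (1 - h (2 - 1 / z))" if "1/2 \<le> z" for z
    proof (cases "z = 1/2")
      case False
      then show ?thesis using that by (simp add: slope_op_def)
    qed (rule glue)
    ultimately show ?thesis using xy by simp
  qed
  have "mono_on {0..1} (slope_op h)"
  proof (rule mono_onI)
    fix x y :: real assume xy: "x \<in> {0..1}" "y \<in> {0..1}" "x \<le> y"
    consider "y \<le> 1/2" | "1/2 \<le> x" | "x \<le> 1/2" "1/2 \<le> y" by linarith
    then show "slope_op h x \<le> slope_op h y"
    proof cases
      case 3
      then show ?thesis using left[of x "1/2"] right[of "1/2" y] xy by auto
    qed (use left right xy in auto)
  qed
  with cont' val show ?thesis by (simp add: admissible_def)
qed

text \<open>Each branch evaluates the function once, with a coefficient of absolute value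
  \<open>rho\<close>.\<close>

lemma slope_op_contraction:
  assumes "\<And>y. y \<in> {0..1} \<Longrightarrow> \<bar>g y - h y\<bar> \<le> d" "y \<in> {0..1}"
  shows "\<bar>slope_op g y - slope_op h y\<bar> \<le> rho * d"
proof (cases "y \<le> 1/2")
  case True
  have "slope_op g y - slope_op h y = - (rho * (g (1 - y) - h (1 - y)))"
    using True by (simp add: slope_op_def algebra_simps)
  moreover have "\<bar>g (1 - y) - h (1 - y)\<bar> \<le> d" using assms True by auto
  ultimately show ?thesis using rho_bounds by (simp add: abs_mult mult_left_mono)
next
  case False
  have "slope_op g y - slope_op h y = rho * (g (2 - 1 / y) - h (2 - 1 / y))"
    using False by (simp add: slope_op_def algebra_simps)
  moreover have "\<bar>g (2 - 1 / y) - h (2 - 1 / y)\<bar> \<le> d"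
    using assms right_branch_bounds[of y] False by auto
  ultimately show ?thesis using rho_bounds by (simp add: abs_mult mult_left_mono)
qed

text \<open>
  The starting point is the quadratic polynomial with the values \<open>0\<close>, \<open>2 - \<phi>\<close>, \<open>1\<close>
  at \<open>0\<close>, \<open>1/2\<close>, \<open>1\<close>; any admissible function would do.
\<close>

definition approx :: "nat \<Rightarrow> real \<Rightarrow> real" where
  "approx n = (slope_op ^^ n) (\<lambda>y. (7 - 4 * golden) * y + (4 * golden - 6) * y\<^sup>2)"

lemma admissible_approx: "admissible (approx n)"
proof (induction n)
  case 0
  have "mono_on {0..1} (\<lambda>y. (7 - 4 * golden) * y + (4 * golden - 6) * y\<^sup>2)"
    using golden_gt golden_less
    by (auto intro!: mono_onI add_mono mult_left_mono power_mono)
  then show ?case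
    by (auto simp: admissible_def approx_def power2_eq_square field_simps intro!: continuous_intros)
next
  case (Suc n)
  then show ?case using admissible_slope_op by (simp add: approx_def)
qed

lemma approx_diff: "y \<in> {0..1} \<Longrightarrow> \<bar>approx (Suc n) y - approx n y\<bar> \<le> rho ^ n"
proof (induction n arbitrary: y)
  case 0
  then show ?case
    using admissible_bounds[OF admissible_approx, of y 0] admissible_bounds[OF admissible_approx, of y 1]
    by auto
next
  case (Suc n)
  then show ?case
    using slope_op_contraction[of "approx (Suc n)" "approx n" "rho ^ n" y] by (simp add: approx_def)
qed

section \<open>The fixed point and its functional equations\<close>

definition conj0 :: "real \<Rightarrow> real" where
  "conj0 y = lim (\<lambda>n. approx n y)"

lemma approx_uniform_limit: "uniform_limit {0..1} approx conj0 sequentially"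
proof -
  \<comment> \<open>The increments are dominated by a geometric series of ratio \<open>rho\<close>,
    so their telescoping sums converge uniformly.\<close>
  have "uniform_limit {0..1} (\<lambda>n y. \<Sum>i<n. approx (Suc i) y - approx i y)
      (\<lambda>y. \<Sum>i. approx (Suc i) y - approx i y) sequentially"
    using approx_diff rho_bounds
    by (intro Weierstrass_m_test[where M = "\<lambda>n. rho ^ n"]) (auto intro!: summable_geometric)
  moreover have "(\<Sum>i<n. approx (Suc i) y - approx i y) = approx n y - approx 0 y" for n y
    by (rule sum_lessThan_telescope)
  ultimately have "uniform_limit {0..1} (\<lambda>n y. approx 0 y + (approx n y - approx 0 y))
      (\<lambda>y. approx 0 y + (\<Sum>i. approx (Suc i) y - approx i y)) sequentially"
    by (intro uniform_limit_add[OF uniform_limit_const]) simp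
  then have "uniformly_convergent_on {0..1} approx"
    by (auto simp: uniformly_convergent_on_def)
  then show ?thesis
    unfolding uniformly_convergent_uniform_limit_iff conj0_def .
qed

lemma approx_tendsto: "y \<in> {0..1} \<Longrightarrow> (\<lambda>n. approx n y) \<longlonglongrightarrow> conj0 y"
  using tendsto_uniform_limitI[OF approx_uniform_limit] by simp

lemma admissible_conj0: "admissible conj0"
  unfolding admissible_def
proof (intro conjI)
  have a: "continuous_on {0..1} (approx n)" "mono_on {0..1} (approx n)"
    "approx n 0 = 0" "approx n (1/2) = 1 - rho" "approx n 1 = 1" for n
    using admissible_approx[of n] by (auto simp: admissible_def)
  show "continuous_on {0..1} conj0"
    using uniform_limit_theorem[OF _ approx_uniform_limit] a(1) by auto
  show "mono_on {0..1} conj0"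
  proof (rule mono_onI)
    fix x y :: real assume xy: "x \<in> {0..1}" "y \<in> {0..1}" "x \<le> y"
    show "conj0 x \<le> conj0 y"
      by (rule LIMSEQ_le[OF approx_tendsto approx_tendsto]) (use xy mono_onD[OF a(2)] in auto)
  qed
  show "conj0 0 = 0" "conj0 (1/2) = 1 - rho" "conj0 1 = 1"
    using a(3-) by (simp_all add: conj0_def)
qed

lemma conj0_fixed:
  assumes "y \<in> {0..1}"
  shows "conj0 y = slope_op conj0 y"
proof (rule LIMSEQ_unique)
  show "(\<lambda>n. approx (Suc n) y) \<longlonglongrightarrow> conj0 y"
    using approx_tendsto[OF assms] by (rule LIMSEQ_Suc)
  have "(\<lambda>n. slope_op (approx n) y) \<longlonglongrightarrow> slope_op conj0 y"
    unfolding slope_op_def using assms right_branch_bounds[of y]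
    by (auto intro!: tendsto_intros approx_tendsto)
  then show "(\<lambda>n. approx (Suc n) y) \<longlonglongrightarrow> slope_op conj0 y" by (simp add: approx_def)
qed

lemma conj0_values: "conj0 0 = 0" "conj0 (1/2) = 1 - rho" "conj0 1 = 1"
  and conj0_cont: "continuous_on {0..1} conj0"
  and conj0_mono: "0 \<le> x \<Longrightarrow> x \<le> y \<Longrightarrow> y \<le> 1 \<Longrightarrow> conj0 x \<le> conj0 y"
  using admissible_conj0 mono_onD[of "{0..1}" conj0 x y] by (auto simp: admissible_def)

lemma conj0_left: "0 \<le> y \<Longrightarrow> y \<le> 1/2 \<Longrightarrow> conj0 (1 - y) = 1 - golden * conj0 y"
  using conj0_fixed[of y] golden_rho by (simp add: slope_op_def) (simp flip: mult.assoc)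

lemma conj0_right:
  assumes "1/2 \<le> y" "y \<le> 1"
  shows "conj0 (2 - 1 / y) = 1 - golden * (1 - conj0 y)"
proof (cases "y = 1/2")
  case True
  show ?thesis using conj0_values golden_rho unfolding True by simp
next
  case False
  then have "1 - conj0 y = rho * (1 - conj0 (2 - 1 / y))"
    using conj0_fixed[of y] assms by (simp add: slope_op_def)
  then have "golden * (1 - conj0 y) = (golden * rho) * (1 - conj0 (2 - 1 / y))" by simp
  then show ?thesis unfolding golden_rho by simp
qed

text \<open>
  This third equation, for the translation on the interval where \<open>S\<close> may be used as well,
  reflects the relation \<open>(S T)\<^sup>3 = 1\<close> of the modular group.
\<close>

lemma conj0_middle:
  assumes "1/3 \<le> y" "y \<le> 1/2"
  shows "conj0 ((1 - 2 * y) / (2 - 3 * y)) = rho - golden * conj0 y"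
proof -
  \<comment> \<open>\<open>P\<close> is computed along two routes: from \<open>y\<close> by way of
    \<open>z\<close> and \<open>1 - z\<close>, and by way of \<open>1 - y\<close> and
    \<open>w\<close>. Comparing the results determines \<open>conj0 z\<close>.\<close>
  define P where "P = conj0 (y / (1 - y))"
  define z where "z = (1 - 2 * y) / (2 - 3 * y)"
  have z: "0 \<le> z" "z \<le> 1/2" "1 - z = (1 - y) / (2 - 3 * y)"
    using assms by (auto simp: z_def field_simps)
  have "2 - 1 / (1 - z) = y / (1 - y)" using assms by (simp add: z(3) field_simps)
  then have 1: "P = 1 - golden * (golden * conj0 z)"
    using conj0_right[of "1 - z"] conj0_left[of z] z(1,2) by (simp add: P_def)
  define w where "w = 2 - 1 / (1 - y)"
  have w: "0 \<le> w" "w \<le> 1/2" "1 - w = y / (1 - y)" using assms by (auto simp: w_def field_simps)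
  define d where "d = 1 - golden * (golden * conj0 y)"
  have "conj0 w = d"
    using conj0_right[of "1 - y"] conj0_left[of y] assms by (simp add: w_def d_def)
  then have "P = 1 - golden * d" using conj0_left[of w] w by (simp add: P_def)
  then have "golden * (golden * conj0 z) = golden * d" using 1 by linarith
  then have "golden * conj0 z = golden * rho - golden * (golden * conj0 y)"
    unfolding d_def golden_rho using rho_bounds mult_left_cancel by blast
  also have "\<dots> = golden * (rho - golden * conj0 y)" by (rule right_diff_distrib[symmetric])
  finally have "conj0 z = rho - golden * conj0 y" using rho_bounds mult_left_cancel by blast
  then show ?thesis by (simp only: z_def)
qed

section \<open>Strict monotonicity of the fixed point\<close>

text \<open>By \<open>conj0_left\<close>, positivity near 0 amounts to values below 1 near 1. There
  the map \<open>2 - 1 / z\<close> of \<open>conj0_right\<close> carries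
  \<open>1 - 1 / (n + 3)\<close> to \<open>1 - 1 / (n + 2)\<close>, so an induction works upward
  from 1/2, where the value is \<open>1 - rho\<close>.\<close>

lemma conj0_pos:
  assumes "0 < x" "x \<le> 1"
  shows "0 < conj0 x"
proof -
  have less_1: "conj0 z < 1" if "0 \<le> z" "z \<le> 1 - 1 / (real n + 2)" for n z
    using that
  proof (induction n arbitrary: z)
    case 0
    then show ?case using conj0_mono[of z "1/2"] conj0_values rho_bounds by simp
  next
    case (Suc n)
    show ?case
    proof (cases "z \<le> 1/2")
      case True
      then show ?thesis using Suc.prems conj0_mono[of z "1/2"] conj0_values rho_bounds by simp
    next
      case False
      have "0 \<le> 1 / (real (Suc n) + 2)" by simp
      then have "z \<le> 1" using Suc.prems by linarith
      have "2 - 1 / z \<le> 1 - 1 / (real n + 2)"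
        using Suc.prems False by (simp add: field_simps)
      then have "conj0 (2 - 1 / z) < 1"
        using Suc.IH right_branch_bounds[of z] False \<open>z \<le> 1\<close> by simp
      then show ?thesis using conj0_right[of z] False \<open>z \<le> 1\<close> golden_gt
        by (simp add: zero_less_mult_iff)
    qed
  qed
  \<comment> \<open>\<open>conj0_left\<close> reaches only up to 1/2; larger \<open>x\<close> follow
    by monotonicity.\<close>
  define z where "z = min x (1/2)"
  have z: "0 < z" "z \<le> 1/2" "z \<le> x" using assms by (auto simp: z_def)
  obtain n :: nat where "1 / z < real n" using reals_Archimedean2 by blast
  then have "1 - z \<le> 1 - 1 / (real n + 2)" using z by (simp add: field_simps)
  then have "conj0 (1 - z) < 1" using less_1 z by simp
  then have "0 < conj0 z" using conj0_left[of z] z golden_gt by (simp add: zero_less_mult_iff)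
  also have "\<dots> \<le> conj0 x" using conj0_mono z assms by simp
  finally show ?thesis .
qed

text \<open>A Euclidean descent on the fraction. Above 1/2, the map \<open>2 - 1 / y\<close> sends
  \<open>p / q\<close> to \<open>(2 * p - q) / p\<close>, with a smaller denominator; below 1/2, the
  reflection \<open>1 - y\<close> leads to the former case. The descent ends at 1/2.\<close>

lemma conj0_strict_rat:
  fixes p q :: nat
  assumes "0 < p" "p < q" "0 \<le> x" "x < real p / real q" "real p / real q < y" "y \<le> 1"
  shows "conj0 x < conj0 y"
  using assms
proof (induction q arbitrary: p x y rule: less_induct)
  case (less q)
  \<comment> \<open>Two functional equations carry \<open>x < 1/2\<close> to a positive point and
    1/2 itself to 0, so positivity of \<open>conj0\<close> gives strictness at 1/2.\<close>
  have half: "conj0 x < conj0 (1/2)" if "0 \<le> x" "x < 1/2" for x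
  proof -
    have "0 < conj0 (2 - 1 / (1 - x))"
      using that by (intro conj0_pos) (auto simp: field_simps)
    also have "\<dots> = 1 - golden * (golden * conj0 x)" using conj0_right[of "1 - x"] conj0_left[of x] that by simp
    finally have "golden\<^sup>2 * conj0 x < 1" by (simp add: power2_eq_square mult.assoc)
    also have "1 = golden\<^sup>2 * conj0 (1/2)"
      unfolding conj0_values using golden_sq by (simp add: power2_eq_square algebra_simps)
    finally show ?thesis using rho_bounds by simp
  qed
  have big: "conj0 x < conj0 y"
    if "1 < 2 * p" "0 < p" "p < q" "0 \<le> x" "x < real p / real q" "real p / real q < y" "y \<le> 1"
       "1/2 < real p / real q" for p x y
  proof -
    \<comment> \<open>Raising \<open>x\<close> to at least 1/2 brings it into the range of
      \<open>conj0_right\<close> and keeps it below \<open>p / q\<close>.\<close>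
    define x' where "x' = max x (1/2)"
    have x': "1/2 \<le> x'" "x' < real p / real q" "x \<le> x'" using that by (auto simp: x'_def)
    have q2: "q < 2 * p" using that by (simp add: field_simps)
    define r where "r = real (2 * p - q) / real p"
    have r: "r = 2 - 1 / (real p / real q)" using q2 that by (simp add: r_def field_simps of_nat_diff)
    have "1 / (real p / real q) < 1 / x'" "1 / y < 1 / (real p / real q)"
      using x' that by (auto intro!: divide_strict_left_mono mult_pos_pos simp del: divide_divide_eq_right)
    then have "2 - 1 / x' < r" "r < 2 - 1 / y" unfolding r by simp_all
    then have "conj0 (2 - 1 / x') < conj0 (2 - 1 / y)"
      using less.IH[of p "2 * p - q" "2 - 1 / x'" "2 - 1 / y"] right_branch_bounds[of x'] right_branch_bounds[of y]
       x' that q2 unfolding r_def by auto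
    then have "conj0 x' < conj0 y"
      using conj0_right[of x'] conj0_right[of y] x' that rho_bounds by auto
    moreover have "conj0 x \<le> conj0 x'" using conj0_mono x' that by auto
    ultimately show ?thesis by simp
  qed
  let ?r = "real p / real q"
  consider "?r = 1/2" | "1/2 < ?r" | "?r < 1/2" by linarith
  then show ?case
  proof cases
    case 1
    then have "conj0 x < conj0 (1/2)" "conj0 (1/2) \<le> conj0 y"
      using less.prems half conj0_mono[of "1/2" y] by auto
    then show ?thesis by simp
  next
    case 2
    then have "1 < 2 * p" using less.prems by (simp add: field_simps)
    then show ?thesis using big[of p x y] less.prems 2 by auto
  next
    case 3
    define y' where "y' = min y (1/2)"
    have y': "y' \<le> 1/2" "?r < y'" "y' \<le> y" using less.prems 3 by (auto simp: y'_def)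
    have xr: "x \<le> 1/2" "0 \<le> y'" using y' less.prems by auto
    have c: "real (q - p) / real q = 1 - ?r" using less.prems by (simp add: of_nat_diff field_simps)
    have "1 < 2 * (q - p)" using less.prems by simp
    then have "conj0 (1 - y') < conj0 (1 - x)"
    proof (rule big[of "q - p"])
      show "1 - y' < real (q - p) / real q" "real (q - p) / real q < 1 - x" "1/2 < real (q - p) / real q"
        unfolding c using less.prems 3 y' by simp_all
    qed (use less.prems y' in auto)
    then have "conj0 x < conj0 y'"
      using conj0_left[of x] conj0_left[of y'] xr y' less.prems rho_bounds by auto
    also have "\<dots> \<le> conj0 y" using conj0_mono y' xr less.prems by auto
    finally show ?thesis .
  qed
qed

lemma conj0_strict:
  assumes "0 \<le> x" "x < y" "y \<le> 1"
  shows "conj0 x < conj0 y"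
proof -
  obtain r where r: "r \<in> \<rat>" "x < r" "r < y" using Rats_dense_in_real[OF \<open>x < y\<close>] by auto
  then obtain p q :: nat where "q \<noteq> 0" and pq: "r = real p / real q"
    using Rats_abs_nat_div_natE[of r] assms by (metis abs_of_nonneg less_eq_real_def order_le_less_trans)
  moreover have "0 < real p / real q" "real p / real q < 1" using pq r assms by linarith+
  then have "0 < p" "p < q" using \<open>q \<noteq> 0\<close> by (auto simp: zero_less_divide_iff)
  ultimately show ?thesis using conj0_strict_rat[of p q x y] assms r by simp
qed

section \<open>The odd conjugacy and the branches of the maps\<close>

text \<open>Oddness matches the symmetry of the branches: negation commutes with \<open>mapS\<close>
  and exchanges \<open>mapT\<close> with \<open>mapTinv\<close>.\<close>

definition psi :: "real \<Rightarrow> real" where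
  "psi x = (if 0 \<le> x then conj0 x else - conj0 (- x))"

lemma psi_uminus: "psi (- x) = - psi x"
  using conj0_values by (simp add: psi_def)

lemma psi_strict: "strict_mono_on {-1..1} psi"
proof (rule strict_mono_onI)
  fix x y :: real assume xy: "x \<in> {-1..1}" "y \<in> {-1..1}" "x < y"
  consider "0 \<le> x" | "x < 0" "0 \<le> y" | "y < 0" by linarith
  then show "psi x < psi y"
  proof cases
    case 2
    then show ?thesis using xy conj0_strict[of 0 "-x"] conj0_mono[of 0 y] conj0_values
      by (simp add: psi_def)
  qed (use xy conj0_strict[of x y] conj0_strict[of "- y" "- x"] in \<open>auto simp: psi_def\<close>)
qed

lemma psi_cont: "continuous_on {-1..1} psi"
proof -
  have "continuous_on ({-1..0} \<union> {0..1}) psi"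
  proof (rule continuous_on_closed_Un)
    have "continuous_on {-1..0} (\<lambda>x. - conj0 (- x))"
      by (intro continuous_intros continuous_on_compose2[OF conj0_cont]) auto
    then show "continuous_on {-1..0} psi"
      by (rule continuous_on_eq) (use conj0_values in \<open>auto simp: psi_def\<close>)
    show "continuous_on {0..1} psi"
      using conj0_cont by (rule continuous_on_eq) (auto simp: psi_def)
  qed auto
  moreover have "{-1..0} \<union> {0..1} = {-1..1::real}" by auto
  ultimately show ?thesis by simp
qed

text \<open>The range starts at \<open>1/3 = kmap (1/2)\<close>, the leftmost position of
  \<open>kmap b\<close>. From 1/2 on the image is nonnegative and \<open>conj0_right\<close>
  applies; below 1/2 it is negative, and \<open>conj0_middle\<close> describes its mirror
  image.\<close>

lemma psi_mapTinv:
  assumes "1/3 \<le> x" "x \<le> 1"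
  shows "psi (kconj e mapTinv x) = 1 - golden * (1 - psi x)"
proof -
  consider "x = 1" | "1/2 \<le> x" "x < 1" | "1/3 \<le> x" "x < 1/2" using assms by linarith
  then show ?thesis
  proof cases
    case 1
    then show ?thesis using conj0_values by (simp add: kconj_T_end psi_def)
  next
    case 2
    then have "kconj e mapTinv x = 2 - 1 / x"
      by (auto simp: kconj_def mapTinv_def kinv_def kmap_def field_simps)
    then show ?thesis using conj0_right[of x] right_branch_bounds[of x] 2 by (simp add: psi_def)
  next
    case 3
    define u where "u = (1 - 2 * x) / (1 - x)"
    have "x / (1 - x) - 1 = - u" "0 \<le> u" using 3 by (auto simp: u_def field_simps)
    then have "kconj e mapTinv x = - (u / (1 + u))"
      using 3 by (simp add: kconj_def mapTinv_def kinv_def kmap_def)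
    also have "u / (1 + u) = (1 - 2 * x) / (2 - 3 * x)" using 3 by (simp add: u_def divide_simps)
    finally have "kconj e mapTinv x = - ((1 - 2 * x) / (2 - 3 * x))" .
    moreover have "0 \<le> (1 - 2 * x) / (2 - 3 * x)" using 3 by simp
    ultimately show ?thesis using conj0_middle[of x] 3
      by (simp add: psi_uminus) (simp add: psi_def algebra_simps)
  qed
qed

lemma psi_mapT:
  assumes "-1 \<le> x" "x \<le> -1/3"
  shows "psi (kconj e mapT x) = -1 + golden * (1 + psi x)"
proof -
  have kmap: "kmap (- u) = - kmap u" for u by (simp add: kmap_def)
  have "kconj e mapT x = - kconj e mapTinv (- x)"
    using assms kmap[of "x / (1 - \<bar>x\<bar>) + 1"]
    by (auto simp: kconj_def mapTinv_def mapT_def kinv_def)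
  then show ?thesis using psi_mapTinv[of "-x" e] assms by (simp add: psi_uminus)
qed

lemma psi_mapS_pos:
  assumes "0 < x" "x \<le> 1/2"
  shows "psi (kconj e mapS x) = -1 + golden * psi x"
proof -
  have "psi (1 - x) = 1 - golden * psi x" using conj0_left[of x] assms by (simp add: psi_def)
  then show ?thesis using psi_uminus[of "1 - x"] assms by (simp add: kconj_S)
qed

lemma psi_mapS_neg:
  assumes "-1/2 \<le> x" "x < 0"
  shows "psi (kconj e mapS x) = 1 + golden * psi x"
proof -
  have "psi (1 + x) = 1 - golden * psi (- x)" using conj0_left[of "-x"] assms by (simp add: psi_def)
  then show ?thesis using psi_uminus[of x] assms by (simp add: kconj_S add.commute)
qed


section \<open>Entropy of the maps on the square\<close>

text \<open>The square is what makes the branch equations available: the breaks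
  \<open>kmap a\<close> and \<open>kmap b\<close> have absolute value between 1/3 and 1/2, so
  translations act only where it is at least 1/3 and the inversion only where it is at most 1/2. The
  point 0 is a break because the inversion jumps there, whatever \<open>e\<close> is.\<close>

lemma constant_slope_ftilde:
  assumes ab: "a \<in> {-1..-1/2}" "b \<in> {1/2..1}" and e: "e \<in> {-1, 1}"
  shows "constant_slope (ftilde e a b) psi golden {kmap a, 0, kmap b}"
proof
  have ka: "-1/2 \<le> kmap a" "kmap a \<le> -1/3" using ab by (auto simp: kmap_def field_simps)
  have kb: "1/3 \<le> kmap b" "kmap b \<le> 1/2" using ab by (auto simp: kmap_def field_simps)
  fix x y :: real
  assume xy: "-1 \<le> x" "x \<le> y" "y \<le> 1" "{x..y} \<inter> {kmap a, 0, kmap b} = {}"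
  then consider "y < kmap a" | "kmap a < x" "y < 0" | "0 < x" "y < kmap b" | "kmap b < x"
    by fastforce
  then show "psi (ftilde e a b y) - psi (ftilde e a b x) = golden * (psi y - psi x)"
  proof cases
    case 1
    then show ?thesis using xy ka kb
      by (simp add: ftilde_explicit psi_mapT algebra_simps)
  next
    case 2
    then show ?thesis using xy ka kb
      by (simp add: ftilde_explicit psi_mapS_neg algebra_simps)
  next
    case 3
    then show ?thesis using xy ka kb
      by (simp add: ftilde_explicit psi_mapS_pos algebra_simps)
  next
    case 4
    then show ?thesis using xy ka kb
      by (simp add: ftilde_explicit psi_mapTinv algebra_simps)
  qed
next
  show "psi (-1) = -1" "psi 1 = 1" using conj0_values by (auto simp: psi_def)
qed (use golden_gt psi_cont psi_strict ftilde_in_interval[OF e] in \<open>auto simp del: atLeastAtMost_iff\<close>)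

theorem theorem1:
  fixes a b e :: real
  assumes "(a, b) \<in> {-1..-1/2} \<times> {1/2..1}"
    and "e \<in> {-1, 1}"
  shows "has_htop {-1..1} (ftilde e a b) (ln ((1 + sqrt 5) / 2)) \<and>
         has_htop_rbar (fab a b) (ln ((1 + sqrt 5) / 2))"
proof -
  \<comment> \<open>The growth condition under which break points are
    \<open>O(golden ^ n)\<close>.\<close>
  have "2 < golden\<^sup>2" using golden_sq golden_gt by simp
  then have "has_htop {-1..1} (ftilde e' a b) (ln golden)" if "e' \<in> {-1, 1}" for e'
    using constant_slope.has_htop_slope[OF constant_slope_ftilde, of a b e'] assms that by auto
  then show ?thesis using assms by (simp add: has_htop_rbar_def golden_def ftilde_def)
qed

end
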